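(* Assume that the transition matrix $Q_\star=Q_{\theta_\star}$ has full rank, that $\min_{1\le i,j\le K}Q_\star(i,j)>0$, and that the initial distribution $\pi^\star$ is the stationary distribution of $Q_\star$. Assume also that, in a neighborhood of $\theta_\star$: for all $x,x'\in\mathcal X$, $\theta\mapsto Q_\theta(x,x')$ is continuously differentiable with a bounded derivative; and for all $x\in\mathcal X$ and all $y\in\mathcal Y$, $\theta\mapsto f^\theta_x(y)$ is continuously differentiable and the norm of its gradient is upper bounded in this neighborhood by $h_x(y)$, where $h_x$ is a function with $\int h_x(y)\,d\mathcal L^D(y)<+\infty$. Let $\widehat\theta=\widehat\theta(Y_{1:p})$ be a consistent estimator of $\theta_\star$ (as $p\to\infty$). Then for any $1\le k\le n$, as $p\to\infty$, $$\|\phi^\star_k(\cdot,Y_{p+1:p+k})-\widehat\phi_k(\cdot,Y_{p+1:p+k})\|_{\mathrm{tv}}=O_{\mathbb P}(\|\widehat\theta-\theta_\star\|_2)$$ and $$\|\phi^\star_{k|n}(\cdot,Y_{p+1:p+n})-\widehat\phi_{k|n}(\cdot,Y_{p+1:p+n})\|_{\mathrm{tv}}=O_{\mathbb P}(\|\widehat\theta-\theta_\star\|_2).$$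
   Context: Setting. $K\ge2$ is an integer, $\mathcal X=\{1,\dots,K\}$, $\mathcal Y\subset\mathbb R^D$, $\mathcal L^D$ is Lebesgue measure on $\mathcal Y$. $(X_j,Y_j)_{j\ge1}$ is a hidden Markov model: $(X_j)$ is a Markov chain on $\mathcal X$ with initial distribution $\pi^\star$ and transition matrix $Q_\star$; conditionally on $(X_j)_{j\ge1}$ the $\mathcal Y$-valued variables $Y_j$ are independent, the conditional law of $Y_\ell$ depends only on $X_\ell$, and given $X_\ell=x$ it has density $f^\star_x$ with respect to $\mathcal L^D$. Only the $Y_j$ are observed; $Y_{a:b}=(Y_a,\dots,Y_b)$. Parametric model: for $\theta$ in a subset of $\mathbb R^q$, $Q_\theta$ is a $K\times K$ transition matrix, $\pi^\theta$ its stationary distribution and $f^\theta_x$ ($x\in\mathcal X$) are densities with respect to $\mathcal L^D$; the true parameter is $\theta_\star$, i.e. $Q_\star=Q_{\theta_\star}$, $\pi^\star=\pi^{\theta_\star}$, $f^\star_x=f^{\theta_\star}_x$. The estimators are $\widehat\pi=\pi^{\widehat\theta}$, $\widehat Q=Q_{\widehat\theta}$, $\widehat f_x=f_x^{\widehat\theta}$, where $\widehat\theta$ is a measurable function of $Y_{1:p}$. Filtering distributions: $$\phi^\star_1(x,y_1)=\frac{\pi^\star(x)f^\star_x(y_1)}{\sum_{x'}\pi^\star(x')f^\star_{x'}(y_1)},\qquad \phi^\star_k(x,y_{1:k})=\frac{\sum_{x'}Q_\star(x',x)f^\star_x(y_k)\phi^\star_{k-1}(x',y_{1:k-1})}{\sum_{x',x''}Q_\star(x',x'')f^\star_{x''}(y_k)\phi^\star_{k-1}(x',y_{1:k-1})}.$$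 Marginal smoothing distributions: $\phi^\star_{n|n}=\phi^\star_n$ and, for $k<n$, $$\phi^\star_{k|n}(x,y_{1:n})=\sum_{x'}\frac{Q_\star(x,x')\phi^\star_k(x,y_{1:k})}{\sum_{z}Q_\star(z,x')\phi^\star_k(z,y_{1:k})}\,\phi^\star_{k+1|n}(x',y_{1:n}).$$ $\widehat\phi_k,\widehat\phi_{k|n}$ are given by the same recursions with $\pi^\star,Q_\star,f^\star$ replaced by $\widehat\pi,\widehat Q,\widehat f$ (assumed well defined). $\|\mu-\nu\|_{\mathrm{tv}}=\sum_{x\in\mathcal X}|\mu(x)-\nu(x)|$; $\|\cdot\|_2$ is the Euclidean norm. $A_p=O_{\mathbb P}(B_p)$ means that for every $\varepsilon>0$ there is $C$ with $\limsup_p\mathbb P(A_p>C B_p)\le\varepsilon$. *)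

theory Defs
  imports "HOL-Probability.Probability"
begin

section \<open>Markov chains and hidden Markov models\<close>

text \<open>The finite type \<open>'k\<close> plays the role of the state space \<open>{1,\<dots>,K}\<close>. Matrix entries are written
  \<open>Q $ x $ x'\<close> with \<open>x\<close> the departure state, so row vectors of probabilities act on the left.\<close>

definition prob_vector :: "real ^ 'k \<Rightarrow> bool" where
  "prob_vector p \<longleftrightarrow> (\<forall>x. 0 \<le> p $ x) \<and> (\<Sum>x\<in>UNIV. p $ x) = 1"

definition transition_matrix :: "real ^ 'k ^ 'k \<Rightarrow> bool" where
  "transition_matrix Q \<longleftrightarrow> (\<forall>x. prob_vector (Q $ x))"

definition stationary_distribution :: "real ^ 'k ^ 'k \<Rightarrow> real ^ 'k \<Rightarrow> bool" where
  "stationary_distribution Q p \<longleftrightarrow> prob_vector p \<and> p v* Q = p"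

definition prob_density :: "'y measure \<Rightarrow> ('y \<Rightarrow> real) \<Rightarrow> bool" where
  "prob_density L g \<longleftrightarrow>
     g \<in> borel_measurable L \<and> (\<forall>y\<in>space L. 0 \<le> g y) \<and> (\<integral>\<^sup>+y. ennreal (g y) \<partial>L) = 1"

text \<open>Time starts at \<open>1\<close>; the value of a process at index \<open>0\<close> is never used.\<close>

definition markov_chain ::
  "'w measure \<Rightarrow> real ^ 'k \<Rightarrow> real ^ 'k ^ 'k \<Rightarrow> (nat \<Rightarrow> 'w \<Rightarrow> 'k) \<Rightarrow> bool" where
  "markov_chain M p Q X \<longleftrightarrow>
     (\<forall>j\<ge>1. X j \<in> measurable M (count_space UNIV)) \<and>
     (\<forall>x. measure M {\<omega> \<in> space M. X 1 \<omega> = x} = p $ x) \<and>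
     (\<forall>n\<ge>1. \<forall>s :: nat \<Rightarrow> 'k. \<forall>x.
        measure M {\<omega> \<in> space M. \<forall>j\<in>{1..n}. X j \<omega> = s j} \<noteq> 0 \<longrightarrow>
        cond_prob M (\<lambda>\<omega>. X (Suc n) \<omega> = x) (\<lambda>\<omega>. \<forall>j\<in>{1..n}. X j \<omega> = s j) = Q $ s n $ x)"

definition hidden_algebra :: "'w measure \<Rightarrow> (nat \<Rightarrow> 'w \<Rightarrow> 'k) \<Rightarrow> 'w measure" where
  "hidden_algebra M X =
     vimage_algebra (space M) (\<lambda>\<omega>. \<lambda>j\<in>{1..}. X j \<omega>) (\<Pi>\<^sub>M j\<in>{1..}. count_space UNIV)"

text \<open>The last two conjuncts: conditionally on the whole hidden chain the observations are
  independent, and the conditional law of \<open>Y l\<close> has density \<open>f x\<close> on the event \<open>X l = x\<close>.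
  Here \<open>L\<close> is the dominating measure on the observation space, which is \<open>space L\<close>.\<close>

definition hidden_markov_model ::
  "'w measure \<Rightarrow> 'y measure \<Rightarrow> real ^ 'k \<Rightarrow> real ^ 'k ^ 'k \<Rightarrow> ('k \<Rightarrow> 'y \<Rightarrow> real) \<Rightarrow>
   (nat \<Rightarrow> 'w \<Rightarrow> 'k) \<Rightarrow> (nat \<Rightarrow> 'w \<Rightarrow> 'y) \<Rightarrow> bool" where
  "hidden_markov_model M L p Q f X Y \<longleftrightarrow>
     markov_chain M p Q X \<and>
     (\<forall>j\<ge>1. Y j \<in> measurable M L) \<and>
     (\<forall>J A. finite J \<and> J \<subseteq> {1..} \<and> (\<forall>j\<in>J. A j \<in> sets L) \<longrightarrow>
        (AE \<omega> in M.
           real_cond_exp M (hidden_algebra M X)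
             (indicator {\<omega> \<in> space M. \<forall>j\<in>J. Y j \<omega> \<in> A j}) \<omega> =
           (\<Prod>j\<in>J. real_cond_exp M (hidden_algebra M X)
             (indicator {\<omega> \<in> space M. Y j \<omega> \<in> A j}) \<omega>))) \<and>
     (\<forall>l\<ge>1. \<forall>A\<in>sets L.
        (AE \<omega> in M.
           real_cond_exp M (hidden_algebra M X) (indicator {\<omega> \<in> space M. Y l \<omega> \<in> A}) \<omega> =
           measure (density L (\<lambda>y. ennreal (f (X l \<omega>) y))) A))"

section \<open>Filtering and marginal smoothing distributions\<close>

text \<open>An observation sequence is a function \<open>y\<close> on \<open>nat\<close> of which only \<open>y 1, \<dots>, y k\<close> matter
  (\<open>y 1, \<dots>, y n\<close> for smoothing). The values at time \<open>0\<close> are junk.\<close>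

fun filtering ::
  "real ^ 'k \<Rightarrow> real ^ 'k ^ 'k \<Rightarrow> ('k \<Rightarrow> 'y \<Rightarrow> real) \<Rightarrow> nat \<Rightarrow> (nat \<Rightarrow> 'y) \<Rightarrow> 'k \<Rightarrow> real" where
  "filtering p Q f 0 y x = 0"
| "filtering p Q f (Suc 0) y x = p $ x * f x (y 1) / (\<Sum>x'\<in>UNIV. p $ x' * f x' (y 1))"
| "filtering p Q f (Suc (Suc k)) y x =
     (\<Sum>x'\<in>UNIV. Q $ x' $ x * f x (y (Suc (Suc k))) * filtering p Q f (Suc k) y x') /
     (\<Sum>x'\<in>UNIV. \<Sum>x''\<in>UNIV.
        Q $ x' $ x'' * f x'' (y (Suc (Suc k))) * filtering p Q f (Suc k) y x')"

text \<open>\<open>smoothing p Q f n k y x\<close> is \<open>\<phi>\<^bsub>k|n\<^esub>(x, y\<^bsub>1:n\<^esub>)\<close>, meaningful for \<open>1 \<le> k \<le> n\<close>.\<close>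

function smoothing ::
  "real ^ 'k \<Rightarrow> real ^ 'k ^ 'k \<Rightarrow> ('k \<Rightarrow> 'y \<Rightarrow> real) \<Rightarrow> nat \<Rightarrow> nat \<Rightarrow> (nat \<Rightarrow> 'y) \<Rightarrow> 'k \<Rightarrow> real" where
  "smoothing p Q f n k y x =
     (if k < n then
        (\<Sum>x'\<in>UNIV. Q $ x $ x' * filtering p Q f k y x /
                     (\<Sum>z\<in>UNIV. Q $ z $ x' * filtering p Q f k y z) *
                     smoothing p Q f n (Suc k) y x')
      else filtering p Q f n y x)"
  by pat_completeness auto
termination
  by (relation "Wellfounded.measure (\<lambda>(p, Q, f, n, k, y, x). n - k)") auto

declare smoothing.simps [simp del]

text \<open>Well-definedness: all denominators in the recursions are nonzero.\<close>

definition filtering_well_defined ::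
  "real ^ 'k \<Rightarrow> real ^ 'k ^ 'k \<Rightarrow> ('k \<Rightarrow> 'y \<Rightarrow> real) \<Rightarrow> nat \<Rightarrow> (nat \<Rightarrow> 'y) \<Rightarrow> bool" where
  "filtering_well_defined p Q f k y \<longleftrightarrow>
     (\<Sum>x'\<in>UNIV. p $ x' * f x' (y 1)) \<noteq> 0 \<and>
     (\<forall>j\<in>{2..k}.
        (\<Sum>x'\<in>UNIV. \<Sum>x''\<in>UNIV. Q $ x' $ x'' * f x'' (y j) * filtering p Q f (j - 1) y x') \<noteq> 0)"

definition smoothing_well_defined ::
  "real ^ 'k \<Rightarrow> real ^ 'k ^ 'k \<Rightarrow> ('k \<Rightarrow> 'y \<Rightarrow> real) \<Rightarrow> nat \<Rightarrow> nat \<Rightarrow> (nat \<Rightarrow> 'y) \<Rightarrow> bool" where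
  "smoothing_well_defined p Q f n k y \<longleftrightarrow>
     filtering_well_defined p Q f n y \<and>
     (\<forall>j\<in>{k..<n}. \<forall>x'. (\<Sum>z\<in>UNIV. Q $ z $ x' * filtering p Q f j y z) \<noteq> 0)"

text \<open>The total variation norm without the factor \<open>1/2\<close>.\<close>

definition tv_dist :: "('k::finite \<Rightarrow> real) \<Rightarrow> ('k \<Rightarrow> real) \<Rightarrow> real" where
  "tv_dist \<mu> \<nu> = (\<Sum>x\<in>UNIV. \<bar>\<mu> x - \<nu> x\<bar>)"

section \<open>Estimators and stochastic order symbols\<close>

text \<open>\<open>T p\<close> is a measurable, \<open>\<Theta>\<close>-valued function of the observations \<open>Y 1, \<dots>, Y p\<close>.\<close>

definition estimator_seq ::
  "'w measure \<Rightarrow> 'y measure \<Rightarrow> (nat \<Rightarrow> 'w \<Rightarrow> 'y) \<Rightarrow> 't::topological_space set \<Rightarrow>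
   (nat \<Rightarrow> 'w \<Rightarrow> 't) \<Rightarrow> bool" where
  "estimator_seq M L Y \<Theta> T \<longleftrightarrow>
     (\<forall>p\<ge>1. \<exists>t \<in> measurable (\<Pi>\<^sub>M j\<in>{1..p}. L) (restrict_space borel \<Theta>).
        \<forall>\<omega>\<in>space M. T p \<omega> = t (\<lambda>j\<in>{1..p}. Y j \<omega>))"

definition consistent_estimator ::
  "'w measure \<Rightarrow> (nat \<Rightarrow> 'w \<Rightarrow> 't::metric_space) \<Rightarrow> 't \<Rightarrow> bool" where
  "consistent_estimator M T \<theta> \<longleftrightarrow>
     (\<forall>e>0. (\<lambda>p. measure M {\<omega> \<in> space M. dist (T p \<omega>) \<theta> > e}) \<longlonglongrightarrow> 0)"

text \<open>\<open>A p = O\<^sub>P(B p)\<close> as \<open>p \<rightarrow> \<infinity>\<close>. The outer measure equals the probability on measurable events.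
  It is used because \<open>(\<theta>, y) \<mapsto> f\<^sub>\<theta>(y)\<close> is not assumed jointly measurable, whereas \<open>measure\<close> would
  silently assign \<open>0\<close> to a nonmeasurable event.\<close>

definition bigO_in_prob ::
  "'w measure \<Rightarrow> (nat \<Rightarrow> 'w \<Rightarrow> real) \<Rightarrow> (nat \<Rightarrow> 'w \<Rightarrow> real) \<Rightarrow> bool" where
  "bigO_in_prob M A B \<longleftrightarrow>
     (\<forall>\<epsilon>>0. \<exists>C::real.
        limsup (\<lambda>p. outer_measure_of M {\<omega> \<in> space M. A p \<omega> > C * B p \<omega>}) \<le> ennreal \<epsilon>)"

definition C1_with_gradient ::
  "'t::real_inner set \<Rightarrow> ('t \<Rightarrow> real) \<Rightarrow> ('t \<Rightarrow> 't) \<Rightarrow> bool" where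
  "C1_with_gradient U F G \<longleftrightarrow> (\<forall>t\<in>U. GDERIV F t :> G t) \<and> continuous_on U G"

end

theory Submission
  imports Defs
begin

text \<open>Each \<open>Y\<^bsub>p+j\<^esub>\<close> has a law dominated by \<open>\<Sum>\<^sub>x f\<^sup>\<star>\<^sub>x\<close>, so, outside an event of small probability that is
  uniform in \<open>p\<close>, every observation lies in a set where \<open>f\<^sup>\<star>\<^sub>x\<close> and \<open>h\<^sub>x\<close> are bounded and \<open>\<Sum>\<^sub>x f\<^sup>\<star>\<^sub>x\<close> is
  bounded below. On such observations all denominators of the recursions at \<open>\<theta>\<^sub>\<star>\<close> are bounded away
  from \<open>0\<close>, because the entries of \<open>Q\<^sub>\<star>\<close> are positive, and the filter and the smoother are Lipschitz at
  \<open>\<theta>\<^sub>\<star>\<close> uniformly in the observations. The stationary distribution is Lipschitz at \<open>\<theta>\<^sub>\<star>\<close> by Dobrushin's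
  contraction for \<open>Q\<^sub>\<star>\<close>.\<close>

section \<open>Uniform Lipschitz continuity at a point\<close>

text \<open>Neither the neighbourhood of \<open>t\<close> nor the constants depend on
  \<open>y\<close>; this uniformity later yields one constant for all \<open>p\<close>. Only
  comparisons with the centre \<open>t\<close> are made, since one of the two parameters is always
  the true one. Boundedness at \<open>t\<close> is included because the product rule uses
  it.\<close>

definition ulip_at :: "'y set \<Rightarrow> 't::real_normed_vector \<Rightarrow> ('t \<Rightarrow> 'y \<Rightarrow> real) \<Rightarrow> bool" where
  "ulip_at G t F \<longleftrightarrow>
     (\<exists>B. \<forall>y\<in>G. \<bar>F t y\<bar> \<le> B) \<and>
     (\<exists>C. \<forall>\<^sub>F s in nhds t. \<forall>y\<in>G. \<bar>F s y - F t y\<bar> \<le> C * norm (s - t))"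

lemma ulip_atI:
  assumes "\<And>y. y \<in> G \<Longrightarrow> \<bar>F t y\<bar> \<le> B"
    and "\<forall>\<^sub>F s in nhds t. \<forall>y\<in>G. \<bar>F s y - F t y\<bar> \<le> C * norm (s - t)"
  shows "ulip_at G t F"
  using assms unfolding ulip_at_def by blast

lemma ulip_atE:
  assumes "ulip_at G t F"
  obtains B C where "B \<ge> 0" "C \<ge> 0" "\<And>y. y \<in> G \<Longrightarrow> \<bar>F t y\<bar> \<le> B"
    "\<forall>\<^sub>F s in nhds t. \<forall>y\<in>G. \<bar>F s y - F t y\<bar> \<le> C * norm (s - t)"
proof -
  obtain B C where B: "\<forall>y\<in>G. \<bar>F t y\<bar> \<le> B"
    and C: "\<forall>\<^sub>F s in nhds t. \<forall>y\<in>G. \<bar>F s y - F t y\<bar> \<le> C * norm (s - t)"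
    using assms unfolding ulip_at_def by blast
  have "\<bar>F t y\<bar> \<le> \<bar>B\<bar>" if "y \<in> G" for y
    using B that by force
  moreover have "\<forall>\<^sub>F s in nhds t. \<forall>y\<in>G. \<bar>F s y - F t y\<bar> \<le> \<bar>C\<bar> * norm (s - t)"
    using C
  proof eventually_elim
    case (elim s)
    have "C * norm (s - t) \<le> \<bar>C\<bar> * norm (s - t)"
      by (intro mult_right_mono) auto
    then show ?case using elim by fastforce
  qed
  ultimately show thesis using that[of "\<bar>B\<bar>" "\<bar>C\<bar>"] by simp
qed

lemma eventually_nhds_norm_less:
  fixes t :: "'t::real_normed_vector"
  shows "e > 0 \<Longrightarrow> \<forall>\<^sub>F s in nhds t. norm (s - t) < e"
  unfolding eventually_nhds_metric by (auto simp: dist_norm)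

section \<open>Closure under sums, products and quotients\<close>

lemma ulip_at_const: "ulip_at G t (\<lambda>s y. c)"
  by (rule ulip_atI[where B = "\<bar>c\<bar>" and C = 0]) auto

lemma ulip_at_add:
  assumes "ulip_at G t F" "ulip_at G t H"
  shows "ulip_at G t (\<lambda>s y. F s y + H s y)"
proof -
  obtain B C where F: "\<And>y. y \<in> G \<Longrightarrow> \<bar>F t y\<bar> \<le> B"
    "\<forall>\<^sub>F s in nhds t. \<forall>y\<in>G. \<bar>F s y - F t y\<bar> \<le> C * norm (s - t)"
    by (rule ulip_atE[OF assms(1)]) blast
  obtain B' C' where H: "\<And>y. y \<in> G \<Longrightarrow> \<bar>H t y\<bar> \<le> B'"
    "\<forall>\<^sub>F s in nhds t. \<forall>y\<in>G. \<bar>H s y - H t y\<bar> \<le> C' * norm (s - t)"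
    by (rule ulip_atE[OF assms(2)]) blast
  show ?thesis
  proof (rule ulip_atI)
    show "\<bar>F t y + H t y\<bar> \<le> B + B'" if "y \<in> G" for y
      using F(1)[OF that] H(1)[OF that] by linarith
    show "\<forall>\<^sub>F s in nhds t. \<forall>y\<in>G.
        \<bar>F s y + H s y - (F t y + H t y)\<bar> \<le> (C + C') * norm (s - t)"
      using F(2) H(2)
    proof eventually_elim
      case (elim s)
      then show ?case by (fastforce simp: distrib_right)
    qed
  qed
qed

lemma ulip_at_sum:
  assumes "\<And>i. i \<in> I \<Longrightarrow> ulip_at G t (F i)"
  shows "ulip_at G t (\<lambda>s y. \<Sum>i\<in>I. F i s y)"
  using assms
  by (induction I rule: infinite_finite_induct) (auto intro: ulip_at_const ulip_at_add)

lemma ulip_at_mult: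
  assumes "ulip_at G t F" "ulip_at G t H"
  shows "ulip_at G t (\<lambda>s y. F s y * H s y)"
proof -
  obtain B C where F: "B \<ge> 0" "C \<ge> 0" "\<And>y. y \<in> G \<Longrightarrow> \<bar>F t y\<bar> \<le> B"
    "\<forall>\<^sub>F s in nhds t. \<forall>y\<in>G. \<bar>F s y - F t y\<bar> \<le> C * norm (s - t)"
    by (rule ulip_atE[OF assms(1)]) blast
  obtain B' C' where H: "B' \<ge> 0" "C' \<ge> 0" "\<And>y. y \<in> G \<Longrightarrow> \<bar>H t y\<bar> \<le> B'"
    "\<forall>\<^sub>F s in nhds t. \<forall>y\<in>G. \<bar>H s y - H t y\<bar> \<le> C' * norm (s - t)"
    by (rule ulip_atE[OF assms(2)]) blast
  show ?thesis
  proof (rule ulip_atI)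
    show "\<bar>F t y * H t y\<bar> \<le> B * B'" if "y \<in> G" for y
      using F(1) F(3)[OF that] H(3)[OF that] by (auto simp: abs_mult intro: mult_mono)
    \<comment> \<open>Within distance 1 of \<open>t\<close>, \<open>H s y\<close> stays bounded by
      \<open>B' + C'\<close>; this accounts for the first term of the constant.\<close>
    have "\<forall>\<^sub>F s in nhds t. norm (s - t) < 1"
      by (rule eventually_nhds_norm_less) simp
    with F(4) H(4) show "\<forall>\<^sub>F s in nhds t. \<forall>y\<in>G.
        \<bar>F s y * H s y - F t y * H t y\<bar> \<le> (C * (B' + C') + B * C') * norm (s - t)"
    proof eventually_elim
      case (elim s)
      show ?case
      proof
        fix y assume y: "y \<in> G"
        have "C' * norm (s - t) \<le> C' * 1"
          using elim(3) H(2) by (intro mult_left_mono) auto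
        then have Hs: "\<bar>H s y\<bar> \<le> B' + C'"
          using elim(2) H(3)[OF y] y by fastforce
        have "\<bar>F s y * H s y - F t y * H t y\<bar>
            = \<bar>(F s y - F t y) * H s y + F t y * (H s y - H t y)\<bar>"
          by (simp add: algebra_simps)
        also have "\<dots> \<le> \<bar>F s y - F t y\<bar> * \<bar>H s y\<bar> + \<bar>F t y\<bar> * \<bar>H s y - H t y\<bar>"
          by (metis abs_mult abs_triangle_ineq)
        also have "\<dots> \<le> (C * norm (s - t)) * (B' + C') + B * (C' * norm (s - t))"
          using elim y Hs F H by (intro add_mono mult_mono) auto
        finally show "\<bar>F s y * H s y - F t y * H t y\<bar> \<le> (C * (B' + C') + B * C') * norm (s - t)"
          by (simp add: algebra_simps)
      qed
    qed
  qed
qed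

text \<open>A lower bound at \<open>t\<close> alone suffices: by the Lipschitz bound,
  \<open>F s y\<close> stays above \<open>c / 2\<close> on a ball whose radius depends on
  \<open>c\<close> and \<open>C\<close> but not on \<open>y\<close>. No positivity of denominators
  at other parameters has to be supplied.\<close>

lemma ulip_at_inverse:
  assumes "ulip_at G t F" and c: "c > 0" and lower: "\<And>y. y \<in> G \<Longrightarrow> F t y \<ge> c"
  shows "ulip_at G t (\<lambda>s y. inverse (F s y))"
proof -
  obtain B C where F: "B \<ge> 0" "C \<ge> 0" "\<And>y. y \<in> G \<Longrightarrow> \<bar>F t y\<bar> \<le> B"
    "\<forall>\<^sub>F s in nhds t. \<forall>y\<in>G. \<bar>F s y - F t y\<bar> \<le> C * norm (s - t)"
    by (rule ulip_atE[OF assms(1)]) blast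
  show ?thesis
  proof (rule ulip_atI)
    show "\<bar>inverse (F t y)\<bar> \<le> inverse c" if "y \<in> G" for y
      using lower[OF that] c by (simp add: le_imp_inverse_le)
    \<comment> \<open>On this ball \<open>F\<close> moves by at most \<open>c / 2\<close>; using
      \<open>C + 1\<close> avoids a zero divisor when \<open>C = 0\<close>.\<close>
    have "\<forall>\<^sub>F s in nhds t. norm (s - t) < c / (2 * (C + 1))"
      using c F(2) by (intro eventually_nhds_norm_less) simp
    with F(4) show "\<forall>\<^sub>F s in nhds t. \<forall>y\<in>G.
        \<bar>inverse (F s y) - inverse (F t y)\<bar> \<le> (inverse (c / 2) * inverse c * C) * norm (s - t)"
    proof eventually_elim
      case (elim s)
      show ?case
      proof
        fix y assume y: "y \<in> G"
        have "C * norm (s - t) \<le> (C + 1) * (c / (2 * (C + 1)))"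
          using elim(2) F(2) c by (intro mult_mono) auto
        also have "\<dots> = c / 2"
          using F(2) by (simp add: field_simps)
        finally have Fs: "F s y \<ge> c / 2"
          using elim(1) y lower[OF y] by fastforce
        have "inverse (F s y) - inverse (F t y) = - (inverse (F s y) * (F s y - F t y) * inverse (F t y))"
          using Fs lower[OF y] c by (intro inverse_diff_inverse) auto
        then have "\<bar>inverse (F s y) - inverse (F t y)\<bar>
            = inverse (F s y) * inverse (F t y) * \<bar>F s y - F t y\<bar>"
          using Fs lower[OF y] c by (simp add: abs_mult)
        also have "\<dots> \<le> inverse (c / 2) * inverse c * (C * norm (s - t))"
          using Fs lower[OF y] c elim(1) y
          by (intro mult_mono le_imp_inverse_le) auto
        finally show "\<bar>inverse (F s y) - inverse (F t y)\<bar>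
            \<le> (inverse (c / 2) * inverse c * C) * norm (s - t)"
          by (simp add: mult.assoc)
      qed
    qed
  qed
qed

lemma ulip_at_divide:
  assumes "ulip_at G t F" "ulip_at G t H" "c > 0" "\<And>y. y \<in> G \<Longrightarrow> H t y \<ge> c"
  shows "ulip_at G t (\<lambda>s y. F s y / H s y)"
  unfolding divide_inverse by (rule ulip_at_mult[OF assms(1) ulip_at_inverse[OF assms(2-4)]])

section \<open>From gradient bounds to Lipschitz bounds\<close>

lemma gradient_bound_lipschitz:
  fixes F :: "'t::real_inner \<Rightarrow> real"
  assumes C1: "C1_with_gradient U F g" and bound: "\<And>s. s \<in> U \<Longrightarrow> norm (g s) \<le> B"
    and ball: "ball t r \<subseteq> U" and s: "s \<in> ball t r"
  shows "\<bar>F s - F t\<bar> \<le> B * norm (s - t)"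
proof -
  have t: "t \<in> ball t r"
    using s by (auto simp: dist_norm intro: le_less_trans[OF norm_ge_zero])
  have "norm (F s - F t) \<le> B * norm (s - t)"
  \<comment> \<open>The mean value inequality is applied on a ball because \<open>U\<close> need not
    be convex.\<close>
  proof (rule differentiable_bound[OF convex_ball _ _ s t])
    fix u assume u: "u \<in> ball t r"
    then have "GDERIV F u :> g u"
      using C1 ball by (auto simp: C1_with_gradient_def)
    then show "(F has_derivative (\<lambda>v. inner v (g u))) (at u within ball t r)"
      unfolding gderiv_def by (rule has_derivative_at_withinI)
    show "onorm (\<lambda>v. inner v (g u)) \<le> B"
    proof (rule onorm_bound)
      show "0 \<le> B"
        using bound u ball norm_ge_zero order_trans by blast
    next
      fix v
      have "norm (inner v (g u)) \<le> norm v * norm (g u)"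
        using Cauchy_Schwarz_ineq2 by simp
      also have "\<dots> \<le> norm v * B"
        using bound u ball by (intro mult_left_mono) auto
      finally show "norm (inner v (g u)) \<le> B * norm v"
        by (simp add: mult.commute)
    qed
  qed
  then show ?thesis by simp
qed

text \<open>The gradient may vary with \<open>y\<close>, but the ball on which the mean value
  inequality applies is chosen from \<open>U\<close> alone, so the neighbourhood is common to all
  \<open>y\<close>.\<close>

lemma ulip_at_gradient:
  fixes F :: "'t::real_inner \<Rightarrow> 'y \<Rightarrow> real"
  assumes U: "open U" "t \<in> U"
    and F: "\<And>y. y \<in> G \<Longrightarrow> \<exists>g. C1_with_gradient U (\<lambda>s. F s y) g \<and> (\<forall>s\<in>U. norm (g s) \<le> C)"
    and B: "\<And>y. y \<in> G \<Longrightarrow> \<bar>F t y\<bar> \<le> B"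
  shows "ulip_at G t F"
proof (rule ulip_atI)
  show "\<bar>F t y\<bar> \<le> B" if "y \<in> G" for y
    using that by (rule B)
next
  obtain r where r: "r > 0" "ball t r \<subseteq> U"
    using U open_contains_ball by blast
  have "\<forall>\<^sub>F s in nhds t. s \<in> ball t r"
    using r(1) by (intro eventually_nhds_in_open) auto
  then show "\<forall>\<^sub>F s in nhds t. \<forall>y\<in>G. \<bar>F s y - F t y\<bar> \<le> C * norm (s - t)"
  proof eventually_elim
    case (elim s)
    show ?case
    proof
      fix y assume "y \<in> G"
      then obtain g where g: "C1_with_gradient U (\<lambda>s. F s y) g" "\<forall>s\<in>U. norm (g s) \<le> C"
        using F by blast
      show "\<bar>F s y - F t y\<bar> \<le> C * norm (s - t)"
        by (rule gradient_bound_lipschitz[OF g(1) _ r(2) elim]) (use g(2) in auto)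
    qed
  qed
qed

section \<open>Perturbation of the stationary distribution\<close>

lemma stationary_distribution_nth:
  assumes "stationary_distribution Q p"
  shows "p $ j = (\<Sum>i\<in>UNIV. Q $ i $ j * p $ i)"
proof -
  have "p v* Q = p"
    using assms by (simp add: stationary_distribution_def)
  from arg_cong[OF this, of "\<lambda>v. v $ j"] show ?thesis
    by (simp add: vector_matrix_mult_def mult.commute)
qed

text \<open>With \<open>v = p' - p\<close> one has \<open>v = v Q + p' (Q' - Q)\<close>, and \<open>v Q = v (Q - m J)\<close>, where \<open>J\<close> is the
  all-ones matrix, since \<open>v\<close> has sum \<open>0\<close>.\<close>

lemma stationary_perturbation:
  fixes Q Q' :: "real ^ 'k::finite ^ 'k"
  assumes Q: "transition_matrix Q" and p: "stationary_distribution Q p"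
    and p': "stationary_distribution Q' p'" and m: "\<And>i j. m \<le> Q $ i $ j"
  shows "real CARD('k) * m * (\<Sum>j\<in>UNIV. \<bar>p' $ j - p $ j\<bar>)
    \<le> (\<Sum>i\<in>UNIV. \<Sum>j\<in>UNIV. \<bar>Q' $ i $ j - Q $ i $ j\<bar>)"
proof -
  define v where "v j = p' $ j - p $ j" for j
  have pv: "prob_vector p" "prob_vector p'"
    using p p' by (auto simp: stationary_distribution_def)
  have v0: "(\<Sum>i\<in>UNIV. v i) = 0"
    using pv by (simp add: v_def sum_subtractf prob_vector_def)
  note pj = stationary_distribution_nth[OF p] and p'j = stationary_distribution_nth[OF p']
  \<comment> \<open>The weights \<open>p' $ i\<close> in the perturbation term are at most 1, which
    leaves the entrywise differences of the matrices.\<close>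
  have p'1: "0 \<le> p' $ i" "p' $ i \<le> 1" for i
  proof -
    show "0 \<le> p' $ i" for i using pv(2) by (simp add: prob_vector_def)
    then have "p' $ i \<le> (\<Sum>i\<in>UNIV. p' $ i)"
      by (intro member_le_sum) auto
    then show "p' $ i \<le> 1" using pv(2) by (simp add: prob_vector_def)
  qed
  have vj: "v j = (\<Sum>i\<in>UNIV. v i * (Q $ i $ j - m)) + (\<Sum>i\<in>UNIV. p' $ i * (Q' $ i $ j - Q $ i $ j))" for j
  proof -
    have "(\<Sum>i\<in>UNIV. v i * (Q $ i $ j - m)) = (\<Sum>i\<in>UNIV. v i * Q $ i $ j)"
      using v0 by (simp add: right_diff_distrib sum_subtractf flip: sum_distrib_right)
    moreover have "v j = (\<Sum>i\<in>UNIV. v i * Q $ i $ j) + (\<Sum>i\<in>UNIV. p' $ i * (Q' $ i $ j - Q $ i $ j))"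
      unfolding v_def by (subst pj, subst p'j) (simp add: algebra_simps sum_subtractf sum.distrib)
    ultimately show ?thesis by simp
  qed
  \<comment> \<open>Since \<open>Q $ i $ j - m\<close> is nonnegative, absolute values fall on
    \<open>v i\<close> only.\<close>
  have "\<bar>v j\<bar> \<le> (\<Sum>i\<in>UNIV. \<bar>v i\<bar> * (Q $ i $ j - m)) + (\<Sum>i\<in>UNIV. \<bar>Q' $ i $ j - Q $ i $ j\<bar>)" for j
  proof -
    have "\<bar>v j\<bar> \<le> (\<Sum>i\<in>UNIV. \<bar>v i * (Q $ i $ j - m)\<bar>) + (\<Sum>i\<in>UNIV. \<bar>p' $ i * (Q' $ i $ j - Q $ i $ j)\<bar>)"
      by (subst vj) (intro order_trans[OF abs_triangle_ineq] add_mono sum_abs)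
    also have "\<dots> \<le> (\<Sum>i\<in>UNIV. \<bar>v i\<bar> * (Q $ i $ j - m)) + (\<Sum>i\<in>UNIV. \<bar>Q' $ i $ j - Q $ i $ j\<bar>)"
      using p'1 m by (intro add_mono sum_mono) (auto simp: abs_mult intro: mult_left_le_one_le)
    finally show ?thesis .
  qed
  then have "(\<Sum>j\<in>UNIV. \<bar>v j\<bar>)
      \<le> (\<Sum>j\<in>UNIV. (\<Sum>i\<in>UNIV. \<bar>v i\<bar> * (Q $ i $ j - m)) + (\<Sum>i\<in>UNIV. \<bar>Q' $ i $ j - Q $ i $ j\<bar>))"
    by (rule sum_mono)
  also have "\<dots> = (\<Sum>i\<in>UNIV. \<Sum>j\<in>UNIV. \<bar>v i\<bar> * (Q $ i $ j - m)) + (\<Sum>i\<in>UNIV. \<Sum>j\<in>UNIV. \<bar>Q' $ i $ j - Q $ i $ j\<bar>)"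
    unfolding sum.distrib by (intro arg_cong2[of _ _ _ _ "(+)"]; rule sum.swap)
  \<comment> \<open>Each row of \<open>Q - m J\<close> sums to \<open>1 - CARD('k) * m\<close>, the
    contraction factor. Moving this term to the left leaves the factor \<open>CARD('k) * m\<close>
    of the claim.\<close>
  also have "(\<Sum>i\<in>UNIV. \<Sum>j\<in>UNIV. \<bar>v i\<bar> * (Q $ i $ j - m)) = (1 - real CARD('k) * m) * (\<Sum>i\<in>UNIV. \<bar>v i\<bar>)"
  proof -
    have "(\<Sum>j\<in>UNIV. \<bar>v i\<bar> * (Q $ i $ j - m)) = (1 - real CARD('k) * m) * \<bar>v i\<bar>" for i
      using Q by (simp add: transition_matrix_def prob_vector_def sum_subtractf flip: sum_distrib_left)
    then show ?thesis by (simp add: sum_distrib_left)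
  qed
  finally show ?thesis by (simp add: v_def left_diff_distrib)
qed

text \<open>By stationarity, \<open>p $ j\<close> is the average of column \<open>j\<close> of
  \<open>Q\<close> under the weights \<open>p\<close>.\<close>

lemma stationary_lower_bound:
  assumes "stationary_distribution Q p" and m: "\<And>i j. m \<le> Q $ i $ j"
  shows "m \<le> p $ j"
proof -
  have p: "prob_vector p"
    using assms(1) by (simp add: stationary_distribution_def)
  have "m = (\<Sum>i\<in>UNIV. m * p $ i)"
    using p by (simp add: prob_vector_def flip: sum_distrib_left)
  also have "\<dots> \<le> (\<Sum>i\<in>UNIV. Q $ i $ j * p $ i)"
    using p m by (intro sum_mono mult_right_mono) (auto simp: prob_vector_def)
  also have "\<dots> = p $ j"
    using assms(1) by (rule stationary_distribution_nth[symmetric])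
  finally show ?thesis .
qed

text \<open>The perturbation inequality, divided by \<open>CARD('k) * m\<close>, transfers the
  Lipschitz bounds of the matrix entries to \<open>p\<close>, without any formula for the stationary
  distribution.\<close>

lemma ulip_at_stationary:
  fixes Q :: "'t::real_normed_vector \<Rightarrow> real ^ 'k::finite ^ 'k"
  assumes Q: "\<And>i j. ulip_at G t (\<lambda>s y. Q s $ i $ j)"
    and m: "m > 0" "\<And>i j. m \<le> Q t $ i $ j" and trans: "transition_matrix (Q t)"
    and U: "open U" "t \<in> U" and p: "\<And>s. s \<in> U \<Longrightarrow> stationary_distribution (Q s) (p s)"
  shows "ulip_at G t (\<lambda>s y. p s $ j)"
proof (cases "G = {}")
  case True
  then show ?thesis by (simp add: ulip_at_def)
next
  case False
  then obtain y0 where y0: "y0 \<in> G" by blast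
  \<comment> \<open>Nothing here depends on \<open>y\<close>, so the single point \<open>y0\<close>
    extracts the bound; over an empty \<open>G\<close> the hypothesis would carry no
    information.\<close>
  have "\<exists>C. \<forall>\<^sub>F s in nhds t. \<bar>Q s $ i $ j - Q t $ i $ j\<bar> \<le> C * norm (s - t)" for i j
    using Q[of i j] y0 unfolding ulip_at_def by (auto elim: eventually_mono)
  then have "\<exists>C. \<forall>i j. \<forall>\<^sub>F s in nhds t. \<bar>Q s $ i $ j - Q t $ i $ j\<bar> \<le> C i j * norm (s - t)"
    by (intro choice allI)
  then obtain C where C: "\<And>i j. \<forall>\<^sub>F s in nhds t. \<bar>Q s $ i $ j - Q t $ i $ j\<bar> \<le> C i j * norm (s - t)"
    by blast
  define c where "c = real CARD('k) * m"
  have c: "c > 0" using m by (simp add: c_def)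
  show ?thesis
  proof (rule ulip_atI)
    show "\<bar>p t $ j\<bar> \<le> \<bar>p t $ j\<bar>" by simp
    have "\<forall>\<^sub>F s in nhds t. \<forall>i j. \<bar>Q s $ i $ j - Q t $ i $ j\<bar> \<le> C i j * norm (s - t)"
      using C by (simp add: eventually_all_finite)
    moreover have "\<forall>\<^sub>F s in nhds t. s \<in> U"
      using U by (rule eventually_nhds_in_open)
    ultimately show "\<forall>\<^sub>F s in nhds t. \<forall>y\<in>G.
        \<bar>p s $ j - p t $ j\<bar> \<le> ((\<Sum>i\<in>UNIV. \<Sum>j\<in>UNIV. C i j) / c) * norm (s - t)"
    proof eventually_elim
      case (elim s)
      have "c * \<bar>p s $ j - p t $ j\<bar> \<le> c * (\<Sum>j\<in>UNIV. \<bar>p s $ j - p t $ j\<bar>)"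
        using c by (intro mult_left_mono member_le_sum) auto
      also have "\<dots> \<le> (\<Sum>i\<in>UNIV. \<Sum>j\<in>UNIV. \<bar>Q s $ i $ j - Q t $ i $ j\<bar>)"
        unfolding c_def using trans p elim(2) U m by (intro stationary_perturbation) auto
      also have "\<dots> \<le> (\<Sum>i\<in>UNIV. \<Sum>j\<in>UNIV. C i j * norm (s - t))"
        using elim(1) by (intro sum_mono) auto
      also have "\<dots> = (\<Sum>i\<in>UNIV. \<Sum>j\<in>UNIV. C i j) * norm (s - t)"
        by (simp add: sum_distrib_right)
      finally show ?case
        using c by (simp add: field_simps)
    qed
  qed
qed

section \<open>Filtering and smoothing on well-behaved observations\<close>

text \<open>\<open>G\<close> is the set of observation sequences over which the Lipschitz constants are uniform.\<close>

locale ulip_hmm =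
  fixes G :: "(nat \<Rightarrow> 'y) set" and t :: "'t::real_normed_vector"
    and p :: "'t \<Rightarrow> real ^ 'k::finite" and Q :: "'t \<Rightarrow> real ^ 'k ^ 'k" and f :: "'t \<Rightarrow> 'k \<Rightarrow> 'y \<Rightarrow> real"
    and n :: nat and m \<delta> :: real
  assumes m: "m > 0" and \<delta>: "\<delta> > 0"
    and p_lower: "\<And>x. m \<le> p t $ x" and p_ulip: "\<And>x. ulip_at G t (\<lambda>s y. p s $ x)"
    and Q_lower: "\<And>x x'. m \<le> Q t $ x $ x'" and Q_ulip: "\<And>x x'. ulip_at G t (\<lambda>s y. Q s $ x $ x')"
    and f_nonneg: "\<And>x y j. y \<in> G \<Longrightarrow> j \<in> {1..n} \<Longrightarrow> 0 \<le> f t x (y j)"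
    and f_lower: "\<And>y j. y \<in> G \<Longrightarrow> j \<in> {1..n} \<Longrightarrow> \<delta> \<le> (\<Sum>x\<in>UNIV. f t x (y j))"
    and f_ulip: "\<And>x j. j \<in> {1..n} \<Longrightarrow> ulip_at G t (\<lambda>s y. f s x (y j))"
begin

abbreviation "\<phi> s k y x \<equiv> filtering (p s) (Q s) (f s) k y x"

text \<open>A single emission density may vanish at an observation, but their sum is at least
  \<open>\<delta>\<close> and every weight is at least \<open>m\<close>.\<close>

lemma first_denominator:
  assumes "y \<in> G" "1 \<le> n"
  shows "m * \<delta> \<le> (\<Sum>x\<in>UNIV. p t $ x * f t x (y 1))"
proof -
  have "m * \<delta> \<le> m * (\<Sum>x\<in>UNIV. f t x (y 1))"
    using m assms by (intro mult_left_mono f_lower) auto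
  also have "\<dots> \<le> (\<Sum>x\<in>UNIV. p t $ x * f t x (y 1))"
    unfolding sum_distrib_left using assms p_lower f_nonneg by (intro sum_mono mult_right_mono) auto
  finally show ?thesis .
qed

text \<open>With the entries of \<open>Q t\<close> replaced by \<open>m\<close>, the double sum
  factors into \<open>m\<close>, the sum of the densities, and the total mass 1 of the previous
  filter.\<close>

lemma next_denominator:
  assumes y: "y \<in> G" "Suc (Suc k) \<le> n"
    and \<phi>: "\<And>x. 0 \<le> \<phi> t (Suc k) y x" "(\<Sum>x\<in>UNIV. \<phi> t (Suc k) y x) = 1"
  shows "m * \<delta> \<le> (\<Sum>x'\<in>UNIV. \<Sum>x''\<in>UNIV.
    Q t $ x' $ x'' * f t x'' (y (Suc (Suc k))) * \<phi> t (Suc k) y x')"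
proof -
  have "m * \<delta> \<le> m * (\<Sum>x\<in>UNIV. f t x (y (Suc (Suc k))))"
    using m y by (intro mult_left_mono f_lower) auto
  also have "\<dots> = (\<Sum>x'\<in>UNIV. m * (\<Sum>x\<in>UNIV. f t x (y (Suc (Suc k)))) * \<phi> t (Suc k) y x')"
    using \<phi>(2) by (simp flip: sum_distrib_left)
  also have "\<dots> = (\<Sum>x'\<in>UNIV. \<Sum>x''\<in>UNIV. m * f t x'' (y (Suc (Suc k))) * \<phi> t (Suc k) y x')"
    by (simp add: sum_distrib_left sum_distrib_right)
  also have "\<dots> \<le> (\<Sum>x'\<in>UNIV. \<Sum>x''\<in>UNIV. Q t $ x' $ x'' * f t x'' (y (Suc (Suc k))) * \<phi> t (Suc k) y x')"
    using y \<phi>(1) Q_lower f_nonneg by (intro sum_mono mult_right_mono) auto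
  finally show ?thesis .
qed

text \<open>Positivity of each denominator relies on the previous filter being a probability vector,
  so both facts advance along one induction.\<close>

lemma filtering_prob:
  assumes y: "y \<in> G" and "1 \<le> k" "k \<le> n"
  shows "(\<forall>x. 0 \<le> \<phi> t k y x) \<and> (\<Sum>x\<in>UNIV. \<phi> t k y x) = 1"
  using assms(2,3)
proof (induction k rule: nat_induct_at_least)
  case base
  have D: "0 < (\<Sum>x\<in>UNIV. p t $ x * f t x (y 1))"
    using first_denominator[OF y base] mult_pos_pos[OF m \<delta>] by linarith
  have "0 \<le> p t $ x * f t x (y 1)" for x
    using m p_lower[of x] f_nonneg[OF y, of 1 x] base by (intro mult_nonneg_nonneg) auto
  then show ?case
    using D by (auto simp: sum_divide_distrib[symmetric])
next
  case (Suc k)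
  then obtain k' where k': "k = Suc k'"
    by (metis One_nat_def Suc_le_D)
  have IH: "\<And>x. 0 \<le> \<phi> t (Suc k') y x" "(\<Sum>x\<in>UNIV. \<phi> t (Suc k') y x) = 1"
    using Suc k' by auto
  have D: "0 < (\<Sum>x'\<in>UNIV. \<Sum>x''\<in>UNIV. Q t $ x' $ x'' * f t x'' (y (Suc (Suc k'))) * \<phi> t (Suc k') y x')"
    using next_denominator[OF y _ IH] mult_pos_pos[OF m \<delta>] Suc.prems k' by fastforce
  have N: "0 \<le> Q t $ x' $ x * f t x (y (Suc (Suc k'))) * \<phi> t (Suc k') y x'" for x x'
    using m Q_lower[of x' x] f_nonneg[OF y, of "Suc (Suc k')" x] Suc.prems k' IH(1)
    by (intro mult_nonneg_nonneg) auto
  \<comment> \<open>The numerators summed over all states give exactly the denominator, so the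
    quotients have total mass 1.\<close>
  have "(\<Sum>x\<in>UNIV. \<Sum>x'\<in>UNIV. Q t $ x' $ x * f t x (y (Suc (Suc k'))) * \<phi> t (Suc k') y x')
      = (\<Sum>x'\<in>UNIV. \<Sum>x''\<in>UNIV. Q t $ x' $ x'' * f t x'' (y (Suc (Suc k'))) * \<phi> t (Suc k') y x')"
    by (rule sum.swap)
  then show ?case
    using D N by (auto simp: k' sum_divide_distrib[symmetric] intro!: divide_nonneg_pos sum_nonneg)
qed

text \<open>The closure rules follow the recursion; the only divisions are by denominators that are
  at least \<open>m * \<delta>\<close> at \<open>t\<close>.\<close>

lemma filtering_ulip:
  assumes "1 \<le> k" "k \<le> n"
  shows "ulip_at G t (\<lambda>s y. \<phi> s k y x)"
  using assms
proof (induction k arbitrary: x rule: nat_induct_at_least)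
  case base
  show ?case
    unfolding One_nat_def filtering.simps
    using base m \<delta> first_denominator
    by (intro ulip_at_divide[where c = "m * \<delta>"] ulip_at_sum ulip_at_mult p_ulip f_ulip) auto
next
  case (Suc k)
  then obtain k' where k': "k = Suc k'"
    by (metis One_nat_def Suc_le_D)
  have IH: "ulip_at G t (\<lambda>s y. \<phi> s (Suc k') y x)" for x
    using Suc k' by auto
  have D: "m * \<delta> \<le> (\<Sum>x'\<in>UNIV. \<Sum>x''\<in>UNIV. Q t $ x' $ x'' * f t x'' (y (Suc (Suc k'))) * \<phi> t (Suc k') y x')"
    if "y \<in> G" for y
    using filtering_prob[OF that, of "Suc k'"] Suc.prems k' by (intro next_denominator[OF that]) auto
  show ?case
    unfolding k' filtering.simps(3)
    by (intro ulip_at_divide[where c = "m * \<delta>"] ulip_at_sum ulip_at_mult Q_ulip f_ulip IH D)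
      (use Suc.prems k' m \<delta> in auto)
qed

text \<open>Induction runs downward from \<open>n\<close>, where the smoother is the filter. The
  smoothing denominator averages a column of \<open>Q t\<close> under the filter, so
  \<open>m\<close> bounds it below without \<open>\<delta>\<close>.\<close>

lemma smoothing_ulip:
  assumes "k \<le> n" "1 \<le> k"
  shows "ulip_at G t (\<lambda>s y. smoothing (p s) (Q s) (f s) n k y x)"
  using assms
proof (induction k arbitrary: x rule: inc_induct)
  case base
  then show ?case
    by (simp add: smoothing.simps filtering_ulip)
next
  case (step k)
  have D: "m \<le> (\<Sum>z\<in>UNIV. Q t $ z $ x' * \<phi> t k y z)" if y: "y \<in> G" for y x'
  proof -
    have \<phi>: "\<And>x. 0 \<le> \<phi> t k y x" "(\<Sum>x\<in>UNIV. \<phi> t k y x) = 1"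
      using filtering_prob[OF y, of k] step by auto
    have "m = (\<Sum>z\<in>UNIV. m * \<phi> t k y z)"
      using \<phi>(2) by (simp flip: sum_distrib_left)
    also have "\<dots> \<le> (\<Sum>z\<in>UNIV. Q t $ z $ x' * \<phi> t k y z)"
      using \<phi>(1) Q_lower by (intro sum_mono mult_right_mono) auto
    finally show ?thesis .
  qed
  have "ulip_at G t (\<lambda>s y. \<Sum>x'\<in>UNIV. Q s $ x $ x' * \<phi> s k y x / (\<Sum>z\<in>UNIV. Q s $ z $ x' * \<phi> s k y z) *
      smoothing (p s) (Q s) (f s) n (Suc k) y x')"
    by (intro ulip_at_sum ulip_at_mult ulip_at_divide[where c = m] Q_ulip filtering_ulip D step.IH)
      (use step m in auto)
  then show ?case
    using step by (subst smoothing.simps) simp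
qed

end

text \<open>Finitely many states allow a common neighbourhood and a sum of constants. The
  neighbourhood is returned as an explicit radius, the form in which consistency is used.\<close>

lemma ulip_at_tv_dist:
  assumes "\<And>x. ulip_at G t (\<lambda>s y. F s y x)"
  obtains C r where "r > 0"
    "\<And>s y. norm (s - t) < r \<Longrightarrow> y \<in> G \<Longrightarrow> tv_dist (F t y) (F s y) \<le> C * norm (s - t)"
proof -
  have "\<exists>C. \<forall>\<^sub>F s in nhds t. \<forall>y\<in>G. \<bar>F s y x - F t y x\<bar> \<le> C * norm (s - t)" for x
    using assms[of x] by (simp add: ulip_at_def)
  then have "\<exists>C. \<forall>x. \<forall>\<^sub>F s in nhds t. \<forall>y\<in>G. \<bar>F s y x - F t y x\<bar> \<le> C x * norm (s - t)"
    by (intro choice allI)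
  then obtain C where C: "\<And>x. \<forall>\<^sub>F s in nhds t. \<forall>y\<in>G. \<bar>F s y x - F t y x\<bar> \<le> C x * norm (s - t)"
    by blast
  have "\<forall>\<^sub>F s in nhds t. \<forall>x. \<forall>y\<in>G. \<bar>F s y x - F t y x\<bar> \<le> C x * norm (s - t)"
    using C by (simp add: eventually_all_finite)
  then obtain r where r: "r > 0"
    "\<And>s. dist s t < r \<Longrightarrow> \<forall>x. \<forall>y\<in>G. \<bar>F s y x - F t y x\<bar> \<le> C x * norm (s - t)"
    unfolding eventually_nhds_metric by blast
  show thesis
  proof (rule that[OF r(1)])
    fix s y assume "norm (s - t) < r" "y \<in> G"
    then have "\<bar>F t y x - F s y x\<bar> \<le> C x * norm (s - t)" for x
      using r(2)[of s] by (simp add: dist_norm abs_minus_commute)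
    then show "tv_dist (F t y) (F s y) \<le> (\<Sum>x\<in>UNIV. C x) * norm (s - t)"
      unfolding tv_dist_def sum_distrib_right by (rule sum_mono)
  qed
qed

section \<open>The law of one observation\<close>

lemma subalgebra_hidden_algebra:
  assumes "\<And>j. j \<ge> 1 \<Longrightarrow> X j \<in> measurable M (count_space UNIV)"
  shows "subalgebra M (hidden_algebra M X)"
proof -
  have "(\<lambda>\<omega>. \<lambda>j\<in>{1..}. X j \<omega>) \<in> measurable M (\<Pi>\<^sub>M j\<in>{1..}. count_space UNIV)"
    using assms by (intro measurable_restrict) auto
  then show ?thesis
    unfolding hidden_algebra_def subalgebra_def by (simp add: sets_image_in_sets)
qed

lemma prob_density_prob_space:
  assumes "prob_density L g"
  shows "prob_space (density L (\<lambda>y. ennreal (g y)))"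
proof (rule prob_spaceI)
  have [measurable]: "g \<in> borel_measurable L"
    using assms by (simp add: prob_density_def)
  have "emeasure (density L (\<lambda>y. ennreal (g y))) (space L) = (\<integral>\<^sup>+y. ennreal (g y) \<partial>L)"
    by (subst emeasure_density) (auto intro!: nn_integral_cong)
  then show "emeasure (density L (\<lambda>y. ennreal (g y))) (space (density L (\<lambda>y. ennreal (g y)))) = 1"
    using assms by (simp add: prob_density_def)
qed

text \<open>Given the hidden chain, the conditional probability of the event is one of finitely many
  emission probabilities, hence at most their sum; integrating preserves this. The bound is the same
  for every \<open>l\<close>, which makes the later estimates uniform in \<open>p\<close>.\<close>

lemma hmm_observation_bound:
  fixes X :: "nat \<Rightarrow> 'w \<Rightarrow> 'k::finite"
  assumes "prob_space M" and hmm: "hidden_markov_model M L p Q f X Y" and l: "l \<ge> 1" and A: "A \<in> sets L"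
  shows "measure M {\<omega> \<in> space M. Y l \<omega> \<in> A}
    \<le> (\<Sum>x\<in>UNIV. measure (density L (\<lambda>y. ennreal (f x y))) A)"
proof -
  interpret prob_space M by fact
  interpret finite_measure_subalgebra M "hidden_algebra M X"
    by unfold_locales
      (use hmm in \<open>auto simp: hidden_markov_model_def markov_chain_def intro!: subalgebra_hidden_algebra\<close>)
  let ?E = "{\<omega> \<in> space M. Y l \<omega> \<in> A}"
  have "Y l \<in> measurable M L"
    using hmm l by (simp add: hidden_markov_model_def)
  then have E: "?E \<in> sets M"
    using A by measurable
  then have int: "integrable M (indicator ?E :: 'w \<Rightarrow> real)"
    by (intro integrable_real_indicator) (auto simp: emeasure_eq_measure)
  have "AE \<omega> in M. real_cond_exp M (hidden_algebra M X) (indicator ?E) \<omega>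
      = measure (density L (\<lambda>y. ennreal (f (X l \<omega>) y))) A"
    using hmm l A by (simp add: hidden_markov_model_def)
  then have "AE \<omega> in M. real_cond_exp M (hidden_algebra M X) (indicator ?E) \<omega>
      \<le> (\<Sum>x\<in>UNIV. measure (density L (\<lambda>y. ennreal (f x y))) A)"
  proof eventually_elim
    case (elim \<omega>)
    show ?case
      unfolding elim by (rule member_le_sum) auto
  qed
  then have "(\<integral>\<omega>. real_cond_exp M (hidden_algebra M X) (indicator ?E) \<omega> \<partial>M)
      \<le> (\<Sum>x\<in>UNIV. measure (density L (\<lambda>y. ennreal (f x y))) A)"
    by (intro integral_le_const real_cond_exp_int int)
  then show ?thesis
    using real_cond_exp_int(2)[OF int] E by simp
qed

text \<open>The exceptional sets decrease, as the level grows, to a set where every density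
  vanishes. Each emission law gives that set mass 0, so continuity from above makes the total mass
  small at some level.\<close>

lemma prob_density_tight:
  fixes f h :: "'k::finite \<Rightarrow> 'y \<Rightarrow> real"
  assumes f: "\<And>x. prob_density L (f x)" and h[measurable]: "\<And>x. h x \<in> borel_measurable L" and "e > 0"
  obtains N R \<delta> where "\<delta> > 0" "N \<in> sets L"
    "\<And>x y. y \<in> space L - N \<Longrightarrow> f x y \<le> R \<and> h x y \<le> R \<and> \<delta> \<le> (\<Sum>x\<in>UNIV. f x y)"
    "(\<Sum>x\<in>UNIV. measure (density L (\<lambda>y. ennreal (f x y))) N) < e"
proof -
  \<comment> \<open>One index \<open>i\<close> drives the upper bounds and the lower bound, so the
    family is monotone.\<close>
  define N where "N i = {y \<in> space L. \<not> (\<forall>x. f x y \<le> real i \<and> h x y \<le> real i \<and>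
    inverse (real (Suc i)) \<le> (\<Sum>x\<in>UNIV. f x y))}" for i
  have [measurable]: "f x \<in> borel_measurable L" for x
    using f by (simp add: prob_density_def)
  have N[measurable]: "N i \<in> sets L" for i
    unfolding N_def by measurable
  have "decseq N"
    unfolding decseq_Suc_iff
  proof
    fix i
    have "inverse (real (Suc (Suc i))) \<le> inverse (real (Suc i))"
      by (intro le_imp_inverse_le) auto
    then have "c \<le> real (Suc i) \<and> d \<le> real (Suc i) \<and> inverse (real (Suc (Suc i))) \<le> b"
      if "c \<le> real i \<and> d \<le> real i \<and> inverse (real (Suc i)) \<le> b" for b c d :: real
      using that by linarith
    then show "N (Suc i) \<subseteq> N i"
      unfolding N_def by blast
  qed
  \<comment> \<open>The finite values of \<open>f\<close> and \<open>h\<close> at \<open>y\<close>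
    are eventually below \<open>i\<close>, and a positive sum of densities eventually exceeds
    \<open>inverse (real (Suc i))\<close>. Only a zero sum can keep \<open>y\<close> in all the
    \<open>N i\<close>.\<close>
  have Inter: "f x y = 0" if y: "y \<in> (\<Inter>i. N i)" for x y
  proof (rule ccontr)
    assume "f x y \<noteq> 0"
    have "y \<in> space L"
      using y by (auto simp: N_def)
    then have nonneg: "0 \<le> f z y" for z
      using f by (auto simp: prob_density_def)
    have "f x y \<le> (\<Sum>z\<in>UNIV. f z y)"
      using nonneg by (intro member_le_sum) auto
    then have "0 < (\<Sum>z\<in>UNIV. f z y)"
      using nonneg[of x] \<open>f x y \<noteq> 0\<close> by linarith
    then have "\<forall>\<^sub>F i in sequentially. inverse (real (Suc i)) < (\<Sum>z\<in>UNIV. f z y)"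
      by (rule order_tendstoD(2)[OF LIMSEQ_inverse_real_of_nat])
    moreover have "\<forall>\<^sub>F i in sequentially. \<forall>z. f z y \<le> real i \<and> h z y \<le> real i"
    proof -
      have "\<forall>\<^sub>F i in sequentially. c \<le> real i" for c
        using filterlim_real_sequentially by (simp add: filterlim_at_top)
      then show ?thesis
        by (intro eventually_all_finite) (auto intro: eventually_conj)
    qed
    ultimately have "\<forall>\<^sub>F i in sequentially. y \<notin> N i"
      by eventually_elim (auto simp: N_def less_imp_le)
    then show False
      using y by (auto simp: eventually_sequentially)
  qed
  have "(\<lambda>i. measure (density L (\<lambda>y. ennreal (f x y))) (N i)) \<longlonglongrightarrow> 0" for x
  proof -
    interpret prob_space "density L (\<lambda>y. ennreal (f x y))"
      using f by (rule prob_density_prob_space)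
    have "(\<Inter>i. N i) \<in> sets L"
      by auto
    then have "emeasure (density L (\<lambda>y. ennreal (f x y))) (\<Inter>i. N i)
        = (\<integral>\<^sup>+y. ennreal (f x y) * indicator (\<Inter>i. N i) y \<partial>L)"
      by (subst emeasure_density) auto
    also have "\<dots> = (\<integral>\<^sup>+y. 0 \<partial>L)"
      using Inter by (intro nn_integral_cong) (auto simp: indicator_def)
    finally have "measure (density L (\<lambda>y. ennreal (f x y))) (\<Inter>i. N i) = 0"
      by (simp add: measure_def)
    moreover have "(\<lambda>i. measure (density L (\<lambda>y. ennreal (f x y))) (N i))
        \<longlonglongrightarrow> measure (density L (\<lambda>y. ennreal (f x y))) (\<Inter>i. N i)"
      using \<open>decseq N\<close> N by (intro finite_Lim_measure_decseq) auto
    ultimately show ?thesis by simp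
  qed
  then have "(\<lambda>i. \<Sum>x\<in>UNIV. measure (density L (\<lambda>y. ennreal (f x y))) (N i)) \<longlonglongrightarrow> (\<Sum>x\<in>(UNIV :: 'k set). 0)"
    by (intro tendsto_sum)
  then have "\<forall>\<^sub>F i in sequentially. (\<Sum>x\<in>UNIV. measure (density L (\<lambda>y. ennreal (f x y))) (N i)) < e"
    using \<open>e > 0\<close> by (intro order_tendstoD(2)[where y = 0]) simp_all
  then obtain i where i: "(\<Sum>x\<in>UNIV. measure (density L (\<lambda>y. ennreal (f x y))) (N i)) < e"
    by (auto simp: eventually_sequentially)
  show thesis
  proof (rule that[OF _ N _ i])
    show "inverse (real (Suc i)) > 0"
      by simp
    show "f x y \<le> real i \<and> h x y \<le> real i \<and> inverse (real (Suc i)) \<le> (\<Sum>x\<in>UNIV. f x y)"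
      if "y \<in> space L - N i" for x y
      using that unfolding N_def by blast
  qed
qed

section \<open>Stochastic order\<close>

lemma estimator_seq_measurable:
  assumes "estimator_seq M L Y \<Theta> T" and "p \<ge> 1"
    and Y: "\<And>j. j \<ge> 1 \<Longrightarrow> Y j \<in> measurable M L"
  shows "T p \<in> borel_measurable M"
proof -
  obtain t where t: "t \<in> measurable (\<Pi>\<^sub>M j\<in>{1..p}. L) (restrict_space borel \<Theta>)"
    and T: "\<And>\<omega>. \<omega> \<in> space M \<Longrightarrow> T p \<omega> = t (\<lambda>j\<in>{1..p}. Y j \<omega>)"
    using assms(1,2) unfolding estimator_seq_def by blast
  have "t \<in> borel_measurable (\<Pi>\<^sub>M j\<in>{1..p}. L)"
    using t by (simp add: measurable_restrict_space2_iff)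
  moreover have "(\<lambda>\<omega>. \<lambda>j\<in>{1..p}. Y j \<omega>) \<in> measurable M (\<Pi>\<^sub>M j\<in>{1..p}. L)"
    using Y by (intro measurable_restrict) auto
  ultimately have "(\<lambda>\<omega>. t (\<lambda>j\<in>{1..p}. Y j \<omega>)) \<in> borel_measurable M"
    by (rule measurable_compose[rotated])
  then show ?thesis
    using T by (simp cong: measurable_cong)
qed

text \<open>Consistency puts the estimator within \<open>r\<close> of \<open>t\<close> with
  probability tending to 1, so a pointwise bound near \<open>t\<close>, off events of small
  probability, is enough. The constants \<open>C\<close> and \<open>r\<close> may depend on
  \<open>e\<close> but not on \<open>p\<close>.\<close>

lemma bigO_in_prob_locally:
  fixes T :: "nat \<Rightarrow> 'w \<Rightarrow> 't::euclidean_space"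
  assumes "prob_space M" and T: "\<And>p. p \<ge> 1 \<Longrightarrow> T p \<in> borel_measurable M"
    and consistent: "consistent_estimator M T t"
    and local: "\<And>e. e > 0 \<Longrightarrow> \<exists>E C r. r > 0 \<and> (\<forall>p. E p \<in> sets M \<and> measure M (E p) \<le> e) \<and>
      (\<forall>p. \<forall>\<omega>\<in>space M - E p. norm (T p \<omega> - t) < r \<longrightarrow> A p \<omega> \<le> C * norm (T p \<omega> - t))"
  shows "bigO_in_prob M A (\<lambda>p \<omega>. norm (T p \<omega> - t))"
  unfolding bigO_in_prob_def
proof (intro allI impI)
  interpret prob_space M by fact
  fix e :: real assume e: "e > 0"
  then have "e / 2 > 0"
    by simp
  from local[OF this] obtain E C r where r: "r > 0"
    and E: "\<And>p. E p \<in> sets M" "\<And>p. measure M (E p) \<le> e / 2"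
    and C: "\<And>p \<omega>. \<omega> \<in> space M - E p \<Longrightarrow> norm (T p \<omega> - t) < r \<Longrightarrow> A p \<omega> \<le> C * norm (T p \<omega> - t)"
    by blast
  \<comment> \<open>Off \<open>D p\<close> the distance is at most \<open>r / 2\<close>, hence
    strictly below \<open>r\<close>. The events \<open>E p\<close> and \<open>D p\<close> each take
    half of \<open>e\<close>.\<close>
  define D where "D p = {\<omega> \<in> space M. dist (T p \<omega>) t > r / 2}" for p
  have "(\<lambda>p. measure M (D p)) \<longlonglongrightarrow> 0"
    unfolding D_def using consistent r half_gt_zero unfolding consistent_estimator_def by blast
  then have "\<forall>\<^sub>F p in sequentially. measure M (D p) < e / 2"
    using e by (intro order_tendstoD) auto
  \<comment> \<open>Measurability of \<open>T p\<close> is available from index 1 on.\<close>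
  moreover have "\<forall>\<^sub>F p in sequentially. p \<ge> (1::nat)"
    by (rule eventually_ge_at_top)
  ultimately have "\<forall>\<^sub>F p in sequentially.
      outer_measure_of M {\<omega> \<in> space M. A p \<omega> > C * norm (T p \<omega> - t)} \<le> ennreal e"
  proof eventually_elim
    case (elim p)
    have D: "D p \<in> sets M"
      using T[OF elim(2)] unfolding D_def by measurable
    \<comment> \<open>The event on the left may be nonmeasurable; it is covered by the measurable
      set \<open>E p \<union> D p\<close>, whose outer measure is its probability.\<close>
    have "outer_measure_of M {\<omega> \<in> space M. A p \<omega> > C * norm (T p \<omega> - t)} \<le> outer_measure_of M (E p \<union> D p)"
      using C[of _ p] r by (intro outer_measure_of_mono) (force simp: D_def dist_norm)
    also have "\<dots> = ennreal (measure M (E p \<union> D p))"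
      using E D by (simp add: emeasure_eq_measure)
    also have "\<dots> \<le> ennreal e"
      using measure_Un_le[OF E(1)[of p] D] E(2)[of p] elim(1) by (intro ennreal_leI) linarith
    finally show ?case .
  qed
  then show "\<exists>C. limsup (\<lambda>p. outer_measure_of M {\<omega> \<in> space M. C * norm (T p \<omega> - t) < A p \<omega>}) \<le> ennreal e"
    by (intro exI[of _ C] Limsup_bounded)
qed

section \<open>Assembly of the filtering and smoothing bounds\<close>

theorem theorem2p3:
  fixes M :: "'w measure"
    and S :: "(real ^ 'd) set"
    and L :: "(real ^ 'd) measure"
    and X :: "nat \<Rightarrow> 'w \<Rightarrow> 'k::finite"
    and Y :: "nat \<Rightarrow> 'w \<Rightarrow> real ^ 'd"
    and \<Theta> U :: "(real ^ 'q) set"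
    and \<theta>s :: "real ^ 'q"
    and \<pi> :: "real ^ 'q \<Rightarrow> real ^ 'k"
    and Q :: "real ^ 'q \<Rightarrow> real ^ 'k ^ 'k"
    and f :: "real ^ 'q \<Rightarrow> 'k \<Rightarrow> real ^ 'd \<Rightarrow> real"
    and h :: "'k \<Rightarrow> real ^ 'd \<Rightarrow> real"
    and \<theta>hat :: "nat \<Rightarrow> 'w \<Rightarrow> real ^ 'q"
    and k n :: nat
  assumes K: "CARD('k) \<ge> 2"
    and S: "S \<in> sets borel"
    and L: "L = restrict_space lborel S"
    and model_Q: "\<And>\<theta>. \<theta> \<in> \<Theta> \<Longrightarrow> transition_matrix (Q \<theta>)"
    and model_\<pi>: "\<And>\<theta>. \<theta> \<in> \<Theta> \<Longrightarrow> stationary_distribution (Q \<theta>) (\<pi> \<theta>)"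
    and model_f: "\<And>\<theta> x. \<theta> \<in> \<Theta> \<Longrightarrow> prob_density L (f \<theta> x)"
    and M: "prob_space M"
    and hmm: "hidden_markov_model M L (\<pi> \<theta>s) (Q \<theta>s) (f \<theta>s) X Y"
    and full_rank: "rank (Q \<theta>s) = CARD('k)"
    and positive: "\<And>i j. Q \<theta>s $ i $ j > 0"
    and nbhd: "open U" "\<theta>s \<in> U" "U \<subseteq> \<Theta>"
    and smooth_Q: "\<And>x x'. \<exists>G. C1_with_gradient U (\<lambda>\<theta>. Q \<theta> $ x $ x') G \<and> bounded (G ` U)"
    and smooth_f: "\<And>x y. y \<in> S \<Longrightarrow>
      \<exists>G. C1_with_gradient U (\<lambda>\<theta>. f \<theta> x y) G \<and> (\<forall>\<theta>\<in>U. norm (G \<theta>) \<le> h x y)"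
    and h: "\<And>x. integrable L (h x)"
    and estimator: "estimator_seq M L Y \<Theta> \<theta>hat"
    and consistent: "consistent_estimator M \<theta>hat \<theta>s"
    and kn: "1 \<le> k" "k \<le> n"
    and well_defined: "\<And>p. p \<ge> 1 \<Longrightarrow> AE \<omega> in M.
      smoothing_well_defined (\<pi> (\<theta>hat p \<omega>)) (Q (\<theta>hat p \<omega>)) (f (\<theta>hat p \<omega>)) n k (\<lambda>j. Y (p + j) \<omega>)"
  shows "bigO_in_prob M
      (\<lambda>p \<omega>. tv_dist
        (filtering (\<pi> \<theta>s) (Q \<theta>s) (f \<theta>s) k (\<lambda>j. Y (p + j) \<omega>))
        (filtering (\<pi> (\<theta>hat p \<omega>)) (Q (\<theta>hat p \<omega>)) (f (\<theta>hat p \<omega>)) k (\<lambda>j. Y (p + j) \<omega>)))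
      (\<lambda>p \<omega>. norm (\<theta>hat p \<omega> - \<theta>s))
    \<and> bigO_in_prob M
      (\<lambda>p \<omega>. tv_dist
        (smoothing (\<pi> \<theta>s) (Q \<theta>s) (f \<theta>s) n k (\<lambda>j. Y (p + j) \<omega>))
        (smoothing (\<pi> (\<theta>hat p \<omega>)) (Q (\<theta>hat p \<omega>)) (f (\<theta>hat p \<omega>)) n k (\<lambda>j. Y (p + j) \<omega>)))
      (\<lambda>p \<omega>. norm (\<theta>hat p \<omega> - \<theta>s))"
proof -
  interpret prob_space M by fact
  have \<theta>s: "\<theta>s \<in> \<Theta>"
    using nbhd by auto
  have space_L: "space L = S"
    using L by (simp add: space_restrict_space)
  have Y: "\<And>j. j \<ge> 1 \<Longrightarrow> Y j \<in> measurable M L"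
    using hmm by (simp add: hidden_markov_model_def)
  have f_nonneg: "0 \<le> f \<theta>s x y" if "y \<in> S" for x y
    using model_f[OF \<theta>s] that space_L by (auto simp: prob_density_def)
  define m where "m = Min (range (\<lambda>(i, j). Q \<theta>s $ i $ j))"
  have m: "m > 0" "m \<le> Q \<theta>s $ i $ j" for i j
  proof -
    show "m > 0"
      unfolding m_def using positive by (subst Min_gr_iff) auto
    show "m \<le> Q \<theta>s $ i $ j"
      unfolding m_def by (rule Min_le) (auto intro!: image_eqI[where x = "(i, j)"])
  qed
  \<comment> \<open>The bound on \<open>f \<theta>s\<close> gives boundedness at
    \<open>\<theta>s\<close>, the bound on \<open>h\<close> a gradient bound valid on all of
    \<open>U\<close>, and \<open>\<delta>\<close> controls the denominators. Only the times
    \<open>1..n\<close> read by the recursions are constrained.\<close>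
  define good where "good R \<delta> = {y :: nat \<Rightarrow> real ^ 'd. \<forall>j\<in>{1..n}. y j \<in> S \<and>
    (\<forall>x. f \<theta>s x (y j) \<le> R \<and> h x (y j) \<le> R \<and> \<delta> \<le> (\<Sum>x\<in>UNIV. f \<theta>s x (y j)))}" for R \<delta>
  have ulip: "ulip_hmm (good R \<delta>) \<theta>s \<pi> Q f n m \<delta>" if \<delta>: "\<delta> > 0" for R \<delta>
  proof
    show Q_ulip: "ulip_at (good R \<delta>) \<theta>s (\<lambda>s y. Q s $ x $ x')" for x x'
    proof -
      obtain G B where "C1_with_gradient U (\<lambda>\<theta>. Q \<theta> $ x $ x') G" "\<forall>\<theta>\<in>U. norm (G \<theta>) \<le> B"
        using smooth_Q[of x x'] unfolding bounded_iff by auto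
      then show ?thesis
        by (intro ulip_at_gradient[OF nbhd(1,2), where C = B and B = "\<bar>Q \<theta>s $ x $ x'\<bar>"]) auto
    qed
    show "ulip_at (good R \<delta>) \<theta>s (\<lambda>s y. \<pi> s $ x)" for x
      using nbhd by (intro ulip_at_stationary[OF Q_ulip m model_Q[OF \<theta>s] nbhd(1,2)] model_\<pi>) auto
    show "m \<le> \<pi> \<theta>s $ x" for x
      using model_\<pi>[OF \<theta>s] m(2) by (rule stationary_lower_bound)
    show "ulip_at (good R \<delta>) \<theta>s (\<lambda>s y. f s x (y j))" if j: "j \<in> {1..n}" for x j
    proof (rule ulip_at_gradient[OF nbhd(1,2), where C = R and B = R])
      fix y assume "y \<in> good R \<delta>"
      then have y: "y j \<in> S" "f \<theta>s x (y j) \<le> R" "h x (y j) \<le> R"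
        using j by (auto simp: good_def)
      show "\<exists>g. C1_with_gradient U (\<lambda>s. f s x (y j)) g \<and> (\<forall>s\<in>U. norm (g s) \<le> R)"
        using smooth_f[OF y(1), of x] y(3) by (meson order_trans)
      show "\<bar>f \<theta>s x (y j)\<bar> \<le> R"
        using y f_nonneg by simp
    qed
  qed (use m \<delta> f_nonneg in \<open>auto simp: good_def\<close>)
  \<comment> \<open>Stated for a generic \<open>F\<close> so that it serves both the filter and the
    smoother. The comparison is pointwise in \<open>\<omega>\<close>, so dependence between the
    estimator and the new observations is harmless.\<close>
  have bigO: "bigO_in_prob M
      (\<lambda>p \<omega>. tv_dist (F \<theta>s (\<lambda>j. Y (p + j) \<omega>)) (F (\<theta>hat p \<omega>) (\<lambda>j. Y (p + j) \<omega>)))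
      (\<lambda>p \<omega>. norm (\<theta>hat p \<omega> - \<theta>s))"
    if F: "\<And>R \<delta> x. \<delta> > 0 \<Longrightarrow> ulip_at (good R \<delta>) \<theta>s (\<lambda>s y. F s y x)"
    for F :: "real ^ 'q \<Rightarrow> (nat \<Rightarrow> real ^ 'd) \<Rightarrow> 'k \<Rightarrow> real"
  proof (rule bigO_in_prob_locally[OF M _ consistent])
    show "\<theta>hat p \<in> borel_measurable M" if "p \<ge> 1" for p
      using estimator that Y by (rule estimator_seq_measurable)
    fix e :: real assume "e > 0"
    \<comment> \<open>The budget \<open>e\<close> is shared among the \<open>n\<close> observations
      by a union bound. The set \<open>N\<close> and the constants \<open>R\<close>,
      \<open>\<delta>\<close>, \<open>C\<close>, \<open>r\<close> are then fixed before
      \<open>p\<close> enters.\<close>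
    then have "e / n > 0"
      using kn by simp
    then obtain N R \<delta> where \<delta>: "\<delta> > 0" and N: "N \<in> sets L"
      and bounds: "\<And>x y. y \<in> space L - N \<Longrightarrow>
        f \<theta>s x y \<le> R \<and> h x y \<le> R \<and> \<delta> \<le> (\<Sum>x\<in>UNIV. f \<theta>s x y)"
      and small: "(\<Sum>x\<in>UNIV. measure (density L (\<lambda>y. ennreal (f \<theta>s x y))) N) < e / n"
      by (rule prob_density_tight[of L "f \<theta>s" h, OF model_f[OF \<theta>s] borel_measurable_integrable[OF h]]) blast
    obtain C r where r: "r > 0" and C: "\<And>s y. norm (s - \<theta>s) < r \<Longrightarrow> y \<in> good R \<delta> \<Longrightarrow>
        tv_dist (F \<theta>s y) (F s y) \<le> C * norm (s - \<theta>s)"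
      by (rule ulip_at_tv_dist[of "good R \<delta>" \<theta>s F, OF F[OF \<delta>]]) blast
    define E where "E p = (\<Union>j\<in>{1..n}. {\<omega> \<in> space M. Y (p + j) \<omega> \<in> N})" for p
    have sets: "{\<omega> \<in> space M. Y (p + j) \<omega> \<in> N} \<in> sets M" if "j \<in> {1..n}" for p j
      using measurable_sets[OF Y N, of "p + j"] that by (simp add: vimage_def Int_def conj_commute)
    have "measure M (E p) \<le> e" for p
    proof -
      have "measure M (E p) \<le> (\<Sum>j\<in>{1..n}. measure M {\<omega> \<in> space M. Y (p + j) \<omega> \<in> N})"
        unfolding E_def using sets by (intro measure_UNION_le) auto
      also have "\<dots> \<le> (\<Sum>j\<in>{1..n}. e / n)"
      proof (rule sum_mono)
        fix j assume "j \<in> {1..n}"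
        then have "measure M {\<omega> \<in> space M. Y (p + j) \<omega> \<in> N}
            \<le> (\<Sum>x\<in>UNIV. measure (density L (\<lambda>y. ennreal (f \<theta>s x y))) N)"
          by (intro hmm_observation_bound[OF M hmm _ N]) auto
        with small show "measure M {\<omega> \<in> space M. Y (p + j) \<omega> \<in> N} \<le> e / n"
          by linarith
      qed
      also have "\<dots> = e"
        using kn by simp
      finally show ?thesis .
    qed
    moreover have "E p \<in> sets M" for p
      unfolding E_def using sets by (intro sets.finite_UN) auto
    \<comment> \<open>The shifted sequence reads \<open>Y\<close> at \<open>p + 1\<close> to
      \<open>p + n\<close>, exactly the observations kept out of \<open>N\<close> off
      \<open>E p\<close>.\<close>
    moreover have "(\<lambda>j. Y (p + j) \<omega>) \<in> good R \<delta>" if \<omega>: "\<omega> \<in> space M - E p" for p \<omega>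
      unfolding good_def
    proof (intro CollectI ballI)
      fix j assume j: "j \<in> {1..n}"
      have "Y (p + j) \<omega> \<in> space L"
        using measurable_space[OF Y, of "p + j" \<omega>] \<omega> j by simp
      moreover have "Y (p + j) \<omega> \<notin> N"
        using \<omega> j by (auto simp: E_def)
      ultimately show "Y (p + j) \<omega> \<in> S \<and> (\<forall>x. f \<theta>s x (Y (p + j) \<omega>) \<le> R \<and> h x (Y (p + j) \<omega>) \<le> R \<and>
          \<delta> \<le> (\<Sum>x\<in>UNIV. f \<theta>s x (Y (p + j) \<omega>)))"
        using bounds space_L by blast
    qed
    ultimately show "\<exists>E C r. r > 0 \<and> (\<forall>p. E p \<in> sets M \<and> measure M (E p) \<le> e) \<and>
        (\<forall>p. \<forall>\<omega>\<in>space M - E p. norm (\<theta>hat p \<omega> - \<theta>s) < r \<longrightarrow>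
          tv_dist (F \<theta>s (\<lambda>j. Y (p + j) \<omega>)) (F (\<theta>hat p \<omega>) (\<lambda>j. Y (p + j) \<omega>)) \<le> C * norm (\<theta>hat p \<omega> - \<theta>s))"
      using r C by (intro exI[of _ E] exI[of _ C] exI[of _ r]) blast
  qed
  show ?thesis
  proof
    show "bigO_in_prob M
      (\<lambda>p \<omega>. tv_dist
        (filtering (\<pi> \<theta>s) (Q \<theta>s) (f \<theta>s) k (\<lambda>j. Y (p + j) \<omega>))
        (filtering (\<pi> (\<theta>hat p \<omega>)) (Q (\<theta>hat p \<omega>)) (f (\<theta>hat p \<omega>)) k (\<lambda>j. Y (p + j) \<omega>)))
      (\<lambda>p \<omega>. norm (\<theta>hat p \<omega> - \<theta>s))"
      by (rule bigO[of "\<lambda>s. filtering (\<pi> s) (Q s) (f s) k"])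
        (rule ulip_hmm.filtering_ulip[OF ulip kn])
    show "bigO_in_prob M
      (\<lambda>p \<omega>. tv_dist
        (smoothing (\<pi> \<theta>s) (Q \<theta>s) (f \<theta>s) n k (\<lambda>j. Y (p + j) \<omega>))
        (smoothing (\<pi> (\<theta>hat p \<omega>)) (Q (\<theta>hat p \<omega>)) (f (\<theta>hat p \<omega>)) n k (\<lambda>j. Y (p + j) \<omega>)))
      (\<lambda>p \<omega>. norm (\<theta>hat p \<omega> - \<theta>s))"
      by (rule bigO[of "\<lambda>s. smoothing (\<pi> s) (Q s) (f s) n k"])
        (rule ulip_hmm.smoothing_ulip[OF ulip kn(2,1)])
  qed
qed

end
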